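(* The cross product $\wedge$ on $\mathcal{HH}_3$ has the following properties, for all vector fields $X,Y,Z\in\Gamma(T(\mathcal{HH}_3))$: (i) $\wedge$ is bilinear and anti-symmetric ($X\wedge Y=-Y\wedge X$). (ii) $X\wedge Y$ is perpendicular (with respect to $g$) to both $X$ and $Y$. (iii) $e_1\wedge e_2=e_3$, $e_2\wedge e_3=-e_1$, $e_3\wedge e_1=e_2$. (iv) $(X\wedge Y)\wedge Z=g(X,Z)Y-g(Y,Z)X$. (v) If the mixed product is defined by $(X,Y,Z)=g(X\wedge Y,Z)$, then $(X,Y,Z)=-\det(X,Y,Z)$ and $(X,Y,Z)=(Y,Z,X)=(Z,X,Y)$. (vi) $(X\wedge Y)\wedge Z+(Y\wedge Z)\wedge X+(Z\wedge X)\wedge Y=0$.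
   Context: $\mathcal{HH}_3=(\mathbb{R}^3,g)$ is the 3-dimensional hyperbolic Heisenberg group with the semi-Riemannian metric $g=(dx)^2-(dy)^2-\frac14(dz+2y\,dx-2x\,dy)^2$. The frame $e_1=\partial_x-2y\,\partial_z$, $e_2=\partial_y+2x\,\partial_z$, $e_3=2\,\partial_z$ is orthonormal, with $g(e_1,e_1)=1$, $g(e_2,e_2)=g(e_3,e_3)=-1$. For $X=\sum a_ie_i$ and $Y=\sum b_ie_i$ the cross product is defined by $X\wedge Y=-(a_2b_3-a_3b_2)e_1-(a_1b_3-a_3b_1)e_2+(a_1b_2-a_2b_1)e_3$. $\det(X,Y,Z)$ denotes the determinant of the $3\times3$ matrix whose rows are the components of $X,Y,Z$ in the frame $(e_1,e_2,e_3)$. *)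

theory Defs
  imports "HOL-Analysis.Analysis"
begin

text \<open>Points of the manifold and tangent vectors at a point are both elements of
  \<^typ>\<open>real ^ 3\<close>; a tangent vector is given by its components with respect to
  the coordinate fields of \<open>(x, y, z)\<close>.\<close>

text \<open>\<open>C_k k f\<close>: \<open>f\<close> is \<open>k\<close> times continuously differentiable on the whole space,
  phrased through directional derivatives.\<close>

primrec C_k :: "nat \<Rightarrow> ('a::euclidean_space \<Rightarrow> 'b::real_normed_vector) \<Rightarrow> bool" where
  "C_k 0 f = continuous_on UNIV f"
| "C_k (Suc k) f = ((\<forall>p. f differentiable (at p)) \<and>
     (\<forall>v. C_k k (\<lambda>p. frechet_derivative f (at p) v)))"

definition smooth :: "('a::euclidean_space \<Rightarrow> 'b::real_normed_vector) \<Rightarrow> bool" where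
  "smooth f \<longleftrightarrow> (\<forall>k. C_k k f)"

type_synonym vfield = "real ^ 3 \<Rightarrow> real ^ 3"

definition smooth_vfields :: "vfield set" where
  "smooth_vfields = {X. smooth X}"

text \<open>The 1-form \<open>dz + 2y dx - 2x dy\<close>, and the metric
  \<open>dx\<^sup>2 - dy\<^sup>2 - 1/4 (dz + 2y dx - 2x dy)\<^sup>2\<close> as a symmetric bilinear form.\<close>

definition \<omega> :: "real ^ 3 \<Rightarrow> real ^ 3 \<Rightarrow> real" where
  "\<omega> p u = u $ 3 + 2 * p $ 2 * u $ 1 - 2 * p $ 1 * u $ 2"

definition g :: "real ^ 3 \<Rightarrow> real ^ 3 \<Rightarrow> real ^ 3 \<Rightarrow> real" where
  "g p u v = u $ 1 * v $ 1 - u $ 2 * v $ 2 - 1 / 4 * (\<omega> p u * \<omega> p v)"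

definition e1 :: vfield where "e1 p = vector [1, 0, - 2 * p $ 2]"
definition e2 :: vfield where "e2 p = vector [0, 1, 2 * p $ 1]"
definition e3 :: vfield where "e3 p = vector [0, 0, 2]"

lemma frame_orthonormal:
  "g p (e1 p) (e1 p) = 1" "g p (e2 p) (e2 p) = -1" "g p (e3 p) (e3 p) = -1"
  "g p (e1 p) (e2 p) = 0" "g p (e1 p) (e3 p) = 0" "g p (e2 p) (e3 p) = 0"
  by (simp_all add: g_def \<omega>_def e1_def e2_def e3_def)

definition frame_comps :: "real ^ 3 \<Rightarrow> real ^ 3 \<Rightarrow> real ^ 3" where
  "frame_comps p u = (THE a. u = a $ 1 *\<^sub>R e1 p + a $ 2 *\<^sub>R e2 p + a $ 3 *\<^sub>R e3 p)"

lemma frame_comps_unique: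
  fixes a u p :: "real ^ 3"
  shows "u = a $ 1 *\<^sub>R e1 p + a $ 2 *\<^sub>R e2 p + a $ 3 *\<^sub>R e3 p \<longleftrightarrow>
     a = vector [u $ 1, u $ 2, \<omega> p u / 2]"
  by (auto simp: vec_eq_iff forall_3 \<omega>_def e1_def e2_def e3_def)

lemma frame_comps_eq: "frame_comps p u = vector [u $ 1, u $ 2, \<omega> p u / 2]"
  unfolding frame_comps_def frame_comps_unique by simp

definition cross_at :: "real ^ 3 \<Rightarrow> real ^ 3 \<Rightarrow> real ^ 3 \<Rightarrow> real ^ 3" where
  "cross_at p u v = (let a = frame_comps p u; b = frame_comps p v in
     (- (a $ 2 * b $ 3 - a $ 3 * b $ 2)) *\<^sub>R e1 p
     - (a $ 1 * b $ 3 - a $ 3 * b $ 1) *\<^sub>R e2 p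
     + (a $ 1 * b $ 2 - a $ 2 * b $ 1) *\<^sub>R e3 p)"

definition cross :: "vfield \<Rightarrow> vfield \<Rightarrow> vfield"  (infixl "\<^bold>\<and>" 70) where
  "(X \<^bold>\<and> Y) p = cross_at p (X p) (Y p)"

definition mixed :: "vfield \<Rightarrow> vfield \<Rightarrow> vfield \<Rightarrow> real ^ 3 \<Rightarrow> real" where
  "mixed X Y Z p = g p ((X \<^bold>\<and> Y) p) (Z p)"

definition frame_det :: "vfield \<Rightarrow> vfield \<Rightarrow> vfield \<Rightarrow> real ^ 3 \<Rightarrow> real" where
  "frame_det X Y Z p =
     det (vector [frame_comps p (X p), frame_comps p (Y p), frame_comps p (Z p)] :: real ^ 3 ^ 3)"

text \<open>The cross product of smooth vector fields is again a smooth vector field.\<close>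

lemma C_k_SucD: "C_k (Suc k) f \<Longrightarrow> C_k k f"
proof (induction k arbitrary: f)
  case 0
  then show ?case
    by (auto intro: continuous_at_imp_continuous_on differentiable_imp_continuous_within)
next
  case (Suc k)
  have "f differentiable (at p)" and "C_k k (\<lambda>p. frechet_derivative f (at p) v)" for p v
    using Suc.prems Suc.IH[of "\<lambda>p. frechet_derivative f (at p) v" for v] by simp_all
  then show ?case by simp
qed

lemma C_k_const: "C_k k (\<lambda>_. c)"
  by (induction k arbitrary: c) auto

lemma C_k_linear:
  assumes "bounded_linear h" shows "C_k k (\<lambda>p. h p)"
proof (cases k)
  case 0
  then show ?thesis using assms by (simp add: linear_continuous_on)
next
  case (Suc n)
  have d: "(h has_derivative h) (at p)" for p
    using assms by (rule bounded_linear_imp_has_derivative)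
  have "frechet_derivative h (at p) = h" for p
    by (rule frechet_derivative_at[OF d, symmetric])
  then show ?thesis using Suc d C_k_const by (auto simp: differentiable_def)
qed

lemma C_k_add:
  assumes "C_k k f" "C_k k h" shows "C_k k (\<lambda>p. f p + h p)"
  using assms
proof (induction k arbitrary: f h)
  case 0
  then show ?case by (simp add: continuous_on_add)
next
  case (Suc k)
  have d: "((\<lambda>p. f p + h p) has_derivative
      (\<lambda>v. frechet_derivative f (at p) v + frechet_derivative h (at p) v)) (at p)" for p
    using Suc.prems by (auto intro!: has_derivative_add simp: frechet_derivative_works[symmetric])
  have "frechet_derivative (\<lambda>p. f p + h p) (at p) =
      (\<lambda>v. frechet_derivative f (at p) v + frechet_derivative h (at p) v)" for p
    by (rule frechet_derivative_at[OF d, symmetric])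
  moreover have "(\<lambda>p. f p + h p) differentiable (at p)" for p
    using d by (rule differentiableI)
  ultimately show ?case using Suc by simp
qed

lemma C_k_bilinear:
  assumes "bounded_bilinear B" "C_k k f" "C_k k h" shows "C_k k (\<lambda>p. B (f p) (h p))"
  using assms(2,3)
proof (induction k arbitrary: f h)
  case 0
  then show ?case
    using assms(1) by (simp add: bounded_bilinear.continuous_on)
next
  case (Suc k)
  have d: "((\<lambda>p. B (f p) (h p)) has_derivative
      (\<lambda>v. B (f p) (frechet_derivative h (at p) v) + B (frechet_derivative f (at p) v) (h p))) (at p)"
    for p
    using Suc.prems assms(1)
    by (auto intro!: bounded_bilinear.FDERIV simp: frechet_derivative_works[symmetric])
  have "frechet_derivative (\<lambda>p. B (f p) (h p)) (at p) =
      (\<lambda>v. B (f p) (frechet_derivative h (at p) v) + B (frechet_derivative f (at p) v) (h p))" for p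
    by (rule frechet_derivative_at[OF d, symmetric])
  moreover have "C_k k f" "C_k k h" using Suc.prems C_k_SucD by blast+
  moreover have "(\<lambda>p. B (f p) (h p)) differentiable (at p)" for p
    using d by (rule differentiableI)
  ultimately show ?case using Suc by (simp add: C_k_add)
qed

lemma smooth_mult:
  fixes f h :: "'a::euclidean_space \<Rightarrow> real"
  shows "smooth f \<Longrightarrow> smooth h \<Longrightarrow> smooth (\<lambda>p. f p * h p)"
  by (simp add: smooth_def C_k_bilinear[OF bounded_bilinear_mult])

lemma smooth_scaleR: "smooth f \<Longrightarrow> smooth h \<Longrightarrow> smooth (\<lambda>p. f p *\<^sub>R h p)"
  by (simp add: smooth_def C_k_bilinear[OF bounded_bilinear_scaleR])

lemma smooth_add: "smooth f \<Longrightarrow> smooth h \<Longrightarrow> smooth (\<lambda>p. f p + h p)"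
  by (simp add: smooth_def C_k_add)

lemma smooth_const: "smooth (\<lambda>_. c)"
  by (simp add: smooth_def C_k_const)

lemma smooth_linear: "bounded_linear h \<Longrightarrow> smooth h"
  by (simp add: smooth_def C_k_linear)

lemma smooth_minus:
  fixes f h :: "'a::euclidean_space \<Rightarrow> 'b::real_normed_vector"
  assumes "smooth f" "smooth h" shows "smooth (\<lambda>p. f p - h p)"
  using smooth_add[OF assms(1) smooth_scaleR[OF smooth_const[of "-1"] assms(2)]] by simp

lemma smooth_component: "smooth X \<Longrightarrow> smooth (\<lambda>p. X p $ i :: real)" for X :: vfield
  using C_k_bilinear[OF bounded_bilinear_inner C_k_const[where c="axis i 1"], of _ X]
  by (simp add: smooth_def inner_axis')

lemma smooth_cross:
  assumes "X \<in> smooth_vfields" "Y \<in> smooth_vfields"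
  shows "X \<^bold>\<and> Y \<in> smooth_vfields"
proof -
  have X: "smooth X" and Y: "smooth Y" using assms by (auto simp: smooth_vfields_def)
  have id: "smooth (\<lambda>p :: real ^ 3. p)" by (rule smooth_linear) (rule bounded_linear_ident)
  note s = smooth_minus smooth_add smooth_scaleR smooth_mult smooth_const
  note c = smooth_component[OF X] smooth_component[OF Y] smooth_component[OF id]
  have \<omega>: "smooth (\<lambda>p. (1 / 2) * \<omega> p (X p))" "smooth (\<lambda>p. (1 / 2) * \<omega> p (Y p))"
    unfolding \<omega>_def by (rule c s)+
  then have \<omega>: "smooth (\<lambda>p. \<omega> p (X p) / 2)" "smooth (\<lambda>p. \<omega> p (Y p) / 2)"
    by simp_all
  have vec: "vector [a, b, c] = a *\<^sub>R axis 1 1 + b *\<^sub>R axis 2 1 + c *\<^sub>R (axis 3 1 :: real ^ 3)"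
    for a b c :: real
    by (simp add: vec_eq_iff forall_3 axis_def)
  have e1: "smooth (\<lambda>p. e1 p)"
    unfolding e1_def vec by (rule c s)+
  have e2: "smooth (\<lambda>p. e2 p)"
    unfolding e2_def vec by (rule c s)+
  have e3: "smooth (\<lambda>p. e3 p)"
    unfolding e3_def vec by (rule c s)+
  have eq: "X \<^bold>\<and> Y = (\<lambda>p.
     (\<omega> p (X p) / 2 * Y p $ 2 - X p $ 2 * (\<omega> p (Y p) / 2)) *\<^sub>R e1 p
     - (X p $ 1 * (\<omega> p (Y p) / 2) - \<omega> p (X p) / 2 * Y p $ 1) *\<^sub>R e2 p
     + (X p $ 1 * Y p $ 2 - X p $ 2 * Y p $ 1) *\<^sub>R e3 p)"
    by (rule ext) (simp only: cross_def cross_at_def frame_comps_eq Let_def vector_3 minus_diff_eq)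
  have "smooth (X \<^bold>\<and> Y)"
    unfolding eq by (rule c \<omega> e1 e2 e3 s)+
  then show ?thesis by (simp add: smooth_vfields_def)
qed

end

theory Submission
  imports Defs
begin

text \<open>Every claim is pointwise, so it concerns a single tangent space. There
  \<open>(u $ 1, u $ 2, \<omega> p u)\<close> are linear coordinates, equal to the frame components
  up to a factor 2 in the last one. In them neither \<open>g\<close> nor the cross product depends
  on the point (\<open>cross_at_coords\<close>), so bilinearity, orthogonality, the double product
  formula \<open>cross_at_cross_at\<close> and the determinant formula become polynomial identities.
  The Jacobi identity follows from the double product formula by symmetry of
  \<open>g\<close>.\<close>

lemma vec_eq_iff_\<omega>: "u = v \<longleftrightarrow> u $ 1 = v $ 1 \<and> u $ 2 = v $ 2 \<and> \<omega> p u = \<omega> p v"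
  by (auto simp: vec_eq_iff forall_3 \<omega>_def)

lemma \<omega>_linear:
  "\<omega> p (u + v) = \<omega> p u + \<omega> p v" "\<omega> p (u - v) = \<omega> p u - \<omega> p v"
  "\<omega> p (- u) = - \<omega> p u" "\<omega> p (c *\<^sub>R u) = c * \<omega> p u" "\<omega> p 0 = 0"
  by (simp_all add: \<omega>_def algebra_simps)

text \<open>Up to the factor 2 on \<open>e3 p\<close>, the frame is the basis dual to these
  coordinates; the dependence on the point disappears.\<close>

lemma frame_coords:
  "e1 p $ 1 = 1" "e1 p $ 2 = 0" "\<omega> p (e1 p) = 0"
  "e2 p $ 1 = 0" "e2 p $ 2 = 1" "\<omega> p (e2 p) = 0"
  "e3 p $ 1 = 0" "e3 p $ 2 = 0" "\<omega> p (e3 p) = 2"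
  by (simp_all add: \<omega>_def e1_def e2_def e3_def)

lemma cross_at_coords:
  "cross_at p u v $ 1 = (\<omega> p u * v $ 2 - u $ 2 * \<omega> p v) / 2"
  "cross_at p u v $ 2 = (\<omega> p u * v $ 1 - u $ 1 * \<omega> p v) / 2"
  "\<omega> p (cross_at p u v) = 2 * (u $ 1 * v $ 2 - u $ 2 * v $ 1)"
  by (simp_all add: cross_at_def Let_def frame_comps_eq frame_coords \<omega>_linear field_simps)

lemma cross_at_bilinear:
  "cross_at p (a *\<^sub>R u + b *\<^sub>R v) w = a *\<^sub>R cross_at p u w + b *\<^sub>R cross_at p v w"
  "cross_at p w (a *\<^sub>R u + b *\<^sub>R v) = a *\<^sub>R cross_at p w u + b *\<^sub>R cross_at p w v"
  \<comment> \<open>The vectors do not determine the base point of the coordinates; it must be the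
    \<open>p\<close> at which the product is taken.\<close>
  by (simp_all add: vec_eq_iff_\<omega>[of _ _ p] cross_at_coords \<omega>_linear field_simps)

lemma cross_at_anticommute: "cross_at p u v = - cross_at p v u"
  by (simp add: vec_eq_iff_\<omega>[of _ _ p] cross_at_coords \<omega>_linear field_simps)

lemma cross_at_orthogonal:
  "g p (cross_at p u v) u = 0" "g p (cross_at p u v) v = 0"
  by (simp_all add: g_def cross_at_coords field_simps)

lemma cross_at_frame:
  "cross_at p (e1 p) (e2 p) = e3 p" "cross_at p (e2 p) (e3 p) = - e1 p"
  "cross_at p (e3 p) (e1 p) = e2 p"
  by (simp_all add: vec_eq_iff_\<omega>[of _ _ p] cross_at_coords frame_coords \<omega>_linear)

lemma cross_at_cross_at:
  "cross_at p (cross_at p u v) w = g p u w *\<^sub>R v - g p v w *\<^sub>R u"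
  by (simp add: vec_eq_iff_\<omega>[of _ _ p] cross_at_coords g_def \<omega>_linear field_simps)

text \<open>The frame components of the product are the cofactors of the third row with signs -1, 1,
  1. Pairing with signature 1, -1, -1 makes all three signs negative, which gives minus the
  expansion along that row.\<close>

lemma g_cross_at_eq_det:
  "g p (cross_at p u v) w =
     - det (vector [frame_comps p u, frame_comps p v, frame_comps p w] :: real ^ 3 ^ 3)"
  by (simp add: g_def cross_at_coords frame_comps_eq det_3 field_simps)

lemma g_cross_at_cyclic: "g p (cross_at p u v) w = g p (cross_at p v w) u"
  by (simp add: g_def cross_at_coords field_simps)

lemma cross_at_jacobi:
  "cross_at p (cross_at p u v) w + cross_at p (cross_at p v w) u
     + cross_at p (cross_at p w u) v = 0"
proof -
  \<comment> \<open>After expanding by the double product formula, symmetry makes the six terms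
    cancel in pairs.\<close>
  have "g p x y = g p y x" for x y
    by (simp add: g_def mult.commute)
  then show ?thesis
    by (simp add: cross_at_cross_at)
qed

theorem theorem2p3:
  fixes X Y Z :: vfield
  assumes "X \<in> smooth_vfields" and "Y \<in> smooth_vfields" and "Z \<in> smooth_vfields"
  shows
    "((\<forall>f h. smooth f \<longrightarrow> smooth h \<longrightarrow>
        (\<lambda>p. f p *\<^sub>R X p + h p *\<^sub>R Y p) \<^bold>\<and> Z = (\<lambda>p. f p *\<^sub>R (X \<^bold>\<and> Z) p + h p *\<^sub>R (Y \<^bold>\<and> Z) p) \<and>
        Z \<^bold>\<and> (\<lambda>p. f p *\<^sub>R X p + h p *\<^sub>R Y p) = (\<lambda>p. f p *\<^sub>R (Z \<^bold>\<and> X) p + h p *\<^sub>R (Z \<^bold>\<and> Y) p))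
     \<and> X \<^bold>\<and> Y = (\<lambda>p. - (Y \<^bold>\<and> X) p)) \<and>
     (\<forall>p. g p ((X \<^bold>\<and> Y) p) (X p) = 0 \<and> g p ((X \<^bold>\<and> Y) p) (Y p) = 0) \<and>
     (e1 \<^bold>\<and> e2 = e3 \<and> e2 \<^bold>\<and> e3 = (\<lambda>p. - e1 p) \<and> e3 \<^bold>\<and> e1 = e2) \<and>
     ((X \<^bold>\<and> Y) \<^bold>\<and> Z = (\<lambda>p. g p (X p) (Z p) *\<^sub>R Y p - g p (Y p) (Z p) *\<^sub>R X p)) \<and>
     ((\<forall>p. mixed X Y Z p = - frame_det X Y Z p)
     \<and> mixed X Y Z = mixed Y Z X \<and> mixed Y Z X = mixed Z X Y) \<and>
     (\<forall>p. ((X \<^bold>\<and> Y) \<^bold>\<and> Z) p + ((Y \<^bold>\<and> Z) \<^bold>\<and> X) p + ((Z \<^bold>\<and> X) \<^bold>\<and> Y) p = 0)"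
  \<comment> \<open>Equations between fields become equations at each point, where coefficient
    functions are mere scalars.\<close>
  unfolding cross_def mixed_def frame_det_def fun_eq_iff
  by (intro conjI allI impI cross_at_bilinear cross_at_anticommute cross_at_orthogonal
      cross_at_frame cross_at_cross_at g_cross_at_eq_det g_cross_at_cyclic cross_at_jacobi)

end
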